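(* Let $U\subset\mathbb{R}$ be a fixed nonempty finite set, $A\in\mathbb{R}^{m\times m}$, $B\in\mathbb{R}^{m\times 1}$, and consider the system $$x_{n+1}=Ax_n+Br_n-Bu_n,\qquad x_n\in\mathbb{R}^m,\ r_n\in[-1,1],\ u_n\in U,\ n\in\mathbb{Z}_+,$$ where the pair $(A,B)$ is controllable. Suppose that $A$ has exactly one eigenvalue on the unit circle, and let $e_1$ denote the eigenvector corresponding to the eigenvalue of $A$ that is on the unit circle. Let $\beta>0$ and $Q\in\mathbb{R}^{m\times m}$, $Q=Q'>0$, be such that $\mathcal{C}_{Q,\beta}(e_1)$ is an invariant cylinder for the system. Let $\sigma:\mathbb{R}^m\to\mathbb{R}$ be BIBO, and let $V:\mathbb{R}^m\to\mathbb{R}_+$ be given by $V(\bar x)=\sup_{\tau\in\mathbb{Z}_+}V_\tau(\bar x)$, where this supremum is finite for every $\bar x\in\mathbb{R}^m$ and $V_\tau$ is the function defined in the context. If the set $$S_0=\{x\in\mathcal{C}_{Q,\beta}(e_1):\sigma(x)>-\epsilon_0\}$$ is bounded for some $\epsilon_0>0$, then the set $$M=\{x\in\mathcal{C}_{Q,\beta}(e_1):V(x)\neq 0\}$$ is also bounded.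
   Context: $\mathbb{Z}_+=\{0,1,2,\dots\}$, $\mathbb{R}_+=[0,\infty)$; $Q'$ is the transpose of $Q$ and $Q>0$ means positive definite. BIBO: a function $g:\mathbb{R}^m\to\mathbb{R}$ is BIBO if the image $g(\Xi)$ of every bounded subset $\Xi\subset\mathbb{R}^m$ is bounded. Cylinder: for $v\in\mathbb{R}^m\setminus\{0\}$, $Q\in\mathbb{R}^{m\times m}$ with $Q=Q'>0$, and $\beta>0$, the cylinder with axis $v$ is $$\mathcal{C}_{Q,\beta}(v)=\Big\{p\in\mathbb{R}^m:\ \inf_{t\in\mathbb{R}}(p-tv)^TQ(p-tv)\le\beta\Big\}.$$ It is an invariant cylinder for the system if $Ax+Br-Bu\in\mathcal{C}_{Q,\beta}(v)$ for all $x\in\mathcal{C}_{Q,\beta}(v)$, $r\in[-1,1]$, $u\in U$. Definition of $V_\tau$: for $\bar x\in\mathbb{R}^m$ and $r_n\in[-1,1]$, $u_n\in U$, $\theta_n\in\{0,1\}$, let $x_0=\bar x$, $x_{n+1}=Ax_n+Br_n-Bu_n$, $h_0=1$, $h_{n+1}=\theta_nh_n$. Then $$V_\tau(\bar x)=\max_{\theta_0}\ \min_{r_0}\ \max_{u_0,\theta_1}\ \min_{r_1}\ \max_{u_1,\theta_2}\cdots\min_{r_{\tau-2}}\ \max_{u_{\tau-2},\theta_{\tau-1}}\ \sum_{n=0}^{\tau-1}h_{n+1}\sigma(x_n),$$ the optimizations being over $\theta_n\in\{0,1\}$, $r_n\in[-1,1]$, $u_n\in U$, with $V_0\equiv 0$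 and $V_1(\bar x)=\max\{0,\sigma(\bar x)\}$. A minimum over $r_n$ that is not attained is read as an infimum. *)

theory Defs
  imports "HOL-Analysis.Analysis"
begin

definition BIBO :: "(real ^ 'm \<Rightarrow> real) \<Rightarrow> bool" where
  "BIBO g \<longleftrightarrow> (\<forall>\<Xi>. bounded \<Xi> \<longrightarrow> bounded (g ` \<Xi>))"

definition sym_pos_def :: "real ^ 'm ^ 'm \<Rightarrow> bool" where
  "sym_pos_def Q \<longleftrightarrow> transpose Q = Q \<and> (\<forall>x. x \<noteq> 0 \<longrightarrow> x \<bullet> (Q *v x) > 0)"

text \<open>
  The input matrix with a single column is represented by that column \<open>B\<close>.
  The condition is Kalman's: the matrix with columns \<open>B, A B, \<dots>, A^(m-1) B\<close> has rank \<open>m\<close>.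
\<close>

definition controllable :: "real ^ 'm ^ 'm \<Rightarrow> real ^ 'm \<Rightarrow> bool" where
  "controllable A B \<longleftrightarrow> dim {(((*v) A) ^^ k) B | k. k < CARD('m)} = CARD('m)"

definition is_eigenvector :: "'a::field ^ 'm ^ 'm \<Rightarrow> 'a \<Rightarrow> 'a ^ 'm \<Rightarrow> bool" where
  "is_eigenvector M l v \<longleftrightarrow> v \<noteq> 0 \<and> M *v v = l *s v"

definition is_eigenvalue :: "'a::field ^ 'm ^ 'm \<Rightarrow> 'a \<Rightarrow> bool" where
  "is_eigenvalue M l \<longleftrightarrow> (\<exists>v. is_eigenvector M l v)"

definition cvec :: "real ^ 'm \<Rightarrow> complex ^ 'm" where
  "cvec v = (\<chi> i. complex_of_real (v $ i))"

definition cylinder :: "real ^ 'm ^ 'm \<Rightarrow> real \<Rightarrow> real ^ 'm \<Rightarrow> (real ^ 'm) set" where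
  "cylinder Q \<beta> v = {p. (INF t::real. (p - t *\<^sub>R v) \<bullet> (Q *v (p - t *\<^sub>R v))) \<le> \<beta>}"

definition sys_step :: "real ^ 'm ^ 'm \<Rightarrow> real ^ 'm \<Rightarrow> real ^ 'm \<Rightarrow> real \<Rightarrow> real \<Rightarrow> real ^ 'm" where
  "sys_step A B x r u = A *v x + r *\<^sub>R B - u *\<^sub>R B"

definition invariant_cylinder ::
  "real ^ 'm ^ 'm \<Rightarrow> real ^ 'm \<Rightarrow> real set \<Rightarrow> real ^ 'm ^ 'm \<Rightarrow> real \<Rightarrow> real ^ 'm \<Rightarrow> bool" where
  "invariant_cylinder A B U Q \<beta> v \<longleftrightarrow>
     (\<forall>x \<in> cylinder Q \<beta> v. \<forall>r \<in> {-1..1}. \<forall>u \<in> U. sys_step A B x r u \<in> cylinder Q \<beta> v)"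

primrec traj ::
  "real ^ 'm ^ 'm \<Rightarrow> real ^ 'm \<Rightarrow> real ^ 'm \<Rightarrow> (nat \<Rightarrow> real) \<Rightarrow> (nat \<Rightarrow> real) \<Rightarrow> nat \<Rightarrow> real ^ 'm" where
  "traj A B x r u 0 = x"
| "traj A B x r u (Suc n) = sys_step A B (traj A B x r u n) (r n) (u n)"

primrec hseq :: "(nat \<Rightarrow> real) \<Rightarrow> nat \<Rightarrow> real" where
  "hseq \<theta> 0 = 1"
| "hseq \<theta> (Suc n) = \<theta> n * hseq \<theta> n"

definition payoff ::
  "real ^ 'm ^ 'm \<Rightarrow> real ^ 'm \<Rightarrow> (real ^ 'm \<Rightarrow> real) \<Rightarrow> nat \<Rightarrow> real ^ 'm
     \<Rightarrow> (nat \<Rightarrow> real) \<Rightarrow> (nat \<Rightarrow> real) \<Rightarrow> (nat \<Rightarrow> real) \<Rightarrow> real" where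
  "payoff A B \<sigma> \<tau> x \<theta> r u = (\<Sum>n<\<tau>. hseq \<theta> (n + 1) * \<sigma> (traj A B x r u n))"

text \<open>
  \<open>nested_opt U F k n\<close> applies to \<open>F\<close> the \<open>k\<close> successive blocks
  min over \<open>r\<^sub>n\<close>, max over \<open>(u\<^sub>n, \<theta>\<^bsub>n+1\<^esub>)\<close>, min over \<open>r\<^bsub>n+1\<^esub>\<close>, \<open>\<dots>\<close>;
  the chosen values are recorded in the sequences \<open>\<theta>, r, u\<close>.
\<close>

primrec nested_opt ::
  "real set \<Rightarrow> ((nat \<Rightarrow> real) \<Rightarrow> (nat \<Rightarrow> real) \<Rightarrow> (nat \<Rightarrow> real) \<Rightarrow> real) \<Rightarrow> nat \<Rightarrow> nat
     \<Rightarrow> (nat \<Rightarrow> real) \<Rightarrow> (nat \<Rightarrow> real) \<Rightarrow> (nat \<Rightarrow> real) \<Rightarrow> real" where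
  "nested_opt U F 0 = (\<lambda>n \<theta> r u. F \<theta> r u)"
| "nested_opt U F (Suc k) = (\<lambda>n \<theta> r u.
     INF rn \<in> {-1..1}. MAX (un, th) \<in> U \<times> {0, 1}.
       nested_opt U F k (Suc n) (\<theta>(Suc n := th)) (r(n := rn)) (u(n := un)))"

text \<open>
  For positive \<open>\<tau>\<close> the payoff only reads \<open>\<theta>\<^sub>0, \<dots>, \<theta>\<^bsub>\<tau>-1\<^esub>\<close> and
  \<open>r\<^sub>n, u\<^sub>n\<close> with \<open>n \<le> \<tau> - 2\<close>, all of which are set by the optimizations;
  the initial zero sequences are placeholders.
\<close>

definition Vtau ::
  "real ^ 'm ^ 'm \<Rightarrow> real ^ 'm \<Rightarrow> real set \<Rightarrow> (real ^ 'm \<Rightarrow> real) \<Rightarrow> nat \<Rightarrow> real ^ 'm \<Rightarrow> real" where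
  "Vtau A B U \<sigma> \<tau> x =
     (if \<tau> = 0 then 0
      else MAX th \<in> {0, 1}.
        nested_opt U (payoff A B \<sigma> \<tau> x) (\<tau> - 1) 0 ((\<lambda>_. 0)(0 := th)) (\<lambda>_. 0) (\<lambda>_. 0))"

lemma Vtau_0: "Vtau A B U \<sigma> 0 x = 0"
  by (simp add: Vtau_def)

lemma Vtau_1: "Vtau A B U \<sigma> 1 x = max 0 (\<sigma> x)"
  by (simp add: Vtau_def payoff_def)

lemma Vtau_2:
  "Vtau A B U \<sigma> 2 x =
     (MAX th0 \<in> {0, 1}. INF r0 \<in> {-1..1}. MAX (u0, th1) \<in> U \<times> {0, 1}.
        th0 * \<sigma> x + th1 * th0 * \<sigma> (A *v x + r0 *\<^sub>R B - u0 *\<^sub>R B))"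
  by (simp add: Vtau_def payoff_def numeral_2_eq_2 sys_step_def case_prod_unfold mult.assoc)

end

theory Submission
  imports Defs
begin

text \<open>
  \<open>V\<close> satisfies \<open>V x \<le> max 0 (\<sigma> x + D)\<close> whenever some admissible \<open>r\<close> forces \<open>V \<le> D\<close> at all
  successors of \<open>x\<close>. Controllability turns this into local boundedness: for small \<open>y - x\<close> a small
  input steers \<open>y\<close> into the finitely many states reachable from \<open>x\<close> under \<open>r = 0\<close>. Hence \<open>V\<close> is
  bounded by some \<open>M\<close> on a ball containing \<open>S\<^sub>0\<close>. The eigenvalue of \<open>e\<^sub>1\<close> is \<open>1\<close> or \<open>-1\<close>, so one step
  inside the cylinder lowers the norm by at most a constant, and a far away state pays at least
  \<open>\<epsilon>\<^sub>0\<close> during each of the many steps needed to reach the ball; once this total exceeds \<open>M\<close>,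
  stopping at once is optimal and \<open>V\<close> vanishes.
\<close>

section \<open>The Bellman recursion\<close>

lemma hseq_shift: "hseq \<theta> (Suc n) = \<theta> 0 * hseq (\<lambda>k. \<theta> (Suc k)) n"
  by (induction n) (auto simp: algebra_simps)

lemma traj_shift:
  "traj A B x r u (Suc n) =
     traj A B (sys_step A B x (r 0) (u 0)) (\<lambda>k. r (Suc k)) (\<lambda>k. u (Suc k)) n"
  by (induction n) auto

text \<open>Every weight \<open>hseq \<theta> (n + 1)\<close> contains the factor
  \<open>\<theta> 0\<close>; behind this factor, the later stages form the same game started at the
  successor of \<open>x\<close>.\<close>

lemma payoff_shift:
  "payoff A B \<sigma> (Suc \<tau>) x \<theta> r u = \<theta> 0 * \<sigma> x +
     \<theta> 0 * payoff A B \<sigma> \<tau> (sys_step A B x (r 0) (u 0))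
       (\<lambda>k. \<theta> (Suc k)) (\<lambda>k. r (Suc k)) (\<lambda>k. u (Suc k))"
proof -
  have "payoff A B \<sigma> (Suc \<tau>) x \<theta> r u =
      \<theta> 0 * \<sigma> x + (\<Sum>n<\<tau>. hseq \<theta> (Suc (Suc n)) * \<sigma> (traj A B x r u (Suc n)))"
    unfolding payoff_def by (subst sum.lessThan_Suc_shift) simp
  also have "(\<Sum>n<\<tau>. hseq \<theta> (Suc (Suc n)) * \<sigma> (traj A B x r u (Suc n))) =
      \<theta> 0 * payoff A B \<sigma> \<tau> (sys_step A B x (r 0) (u 0))
       (\<lambda>k. \<theta> (Suc k)) (\<lambda>k. r (Suc k)) (\<lambda>k. u (Suc k))"
    unfolding payoff_def sum_distrib_left
    by (intro sum.cong refl, subst hseq_shift, subst traj_shift) simp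
  finally show ?thesis .
qed

text \<open>Blocks numbered from \<open>Suc n\<close> on never overwrite index 0 of the three
  sequences, so \<open>F\<close> and \<open>G\<close> have to correspond only on sequences that keep
  these initial entries.\<close>

lemma nested_opt_shift:
  assumes "\<And>\<theta>' r' u'. \<theta>' 0 = \<theta> 0 \<Longrightarrow> r' 0 = r 0 \<Longrightarrow> u' 0 = u 0 \<Longrightarrow>
    F \<theta>' r' u' = G (\<lambda>k. \<theta>' (Suc k)) (\<lambda>k. r' (Suc k)) (\<lambda>k. u' (Suc k))"
  shows "nested_opt U F k (Suc n) \<theta> r u =
    nested_opt U G k n (\<lambda>k. \<theta> (Suc k)) (\<lambda>k. r (Suc k)) (\<lambda>k. u (Suc k))"
  using assms
proof (induction k arbitrary: n \<theta> r u)
  case 0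
  then show ?case by simp
next
  case (Suc k)
  have upd: "(\<lambda>k. (f(Suc i := y)) (Suc k)) = (\<lambda>k. f (Suc k))(i := y)"
    for f :: "nat \<Rightarrow> real" and i y
    by (auto simp: fun_eq_iff)
  have "nested_opt U F k (Suc (Suc n)) (\<theta>(Suc (Suc n) := th)) (r(Suc n := rn)) (u(Suc n := un))
     = nested_opt U G k (Suc n) ((\<lambda>k. \<theta> (Suc k))(Suc n := th))
         ((\<lambda>k. r (Suc k))(n := rn)) ((\<lambda>k. u (Suc k))(n := un))" for th rn un
    unfolding upd[symmetric] by (rule Suc.IH) (simp add: Suc.prems)
  then show ?case by simp
qed

text \<open>For each \<open>u\<close> the best \<open>th\<close> continues if \<open>w u\<close> is
  positive and stops otherwise, so the joint choice produces a positive part.\<close>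

lemma Max_stopping:
  fixes a d :: real and w :: "real \<Rightarrow> real"
  assumes "finite U" "U \<noteq> {}" "d \<ge> 0"
  shows "(MAX (u, th) \<in> U \<times> {0, 1}. a + d * th * w u) = a + d * (MAX u \<in> U. max 0 (w u))"
proof (rule Max_eqI)
  show "finite ((\<lambda>(u, th). a + d * th * w u) ` (U \<times> {0, 1}))"
    using assms by auto
next
  fix y assume "y \<in> (\<lambda>(u, th). a + d * th * w u) ` (U \<times> {0, 1})"
  then obtain u th where u: "u \<in> U" "th = 0 \<or> th = 1" "y = a + d * (th * w u)"
    by (auto simp: mult.assoc)
  have "th * w u \<le> max 0 (w u)" using u by auto
  also have "\<dots> \<le> (MAX u \<in> U. max 0 (w u))" using assms u by (intro Max_ge) auto
  finally show "y \<le> a + d * (MAX u \<in> U. max 0 (w u))"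
    using u assms by (simp add: mult_left_mono)
next
  have "(MAX u \<in> U. max 0 (w u)) \<in> (\<lambda>u. max 0 (w u)) ` U"
    using assms by (intro Max_in) auto
  then obtain u where u: "u \<in> U" "(MAX u \<in> U. max 0 (w u)) = max 0 (w u)" by auto
  show "a + d * (MAX u \<in> U. max 0 (w u)) \<in> (\<lambda>(u, th). a + d * th * w u) ` (U \<times> {0, 1})"
    unfolding u(2)
    by (rule image_eqI[of _ _ "(u, if w u > 0 then 1 else 0)"]) (use u in auto)
qed

lemma INF_affine:
  fixes f :: "'a \<Rightarrow> real"
  assumes "I \<noteq> {}" "bdd_below (f ` I)" "d = 0 \<or> d = 1"
  shows "(INF i \<in> I. a + d * f i) = a + d * (INF i \<in> I. f i)"
proof (cases "d = 0")
  case True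
  then show ?thesis using assms by simp
next
  case False
  have "(INF i \<in> I. a + f i) = a + (INF i \<in> I. f i)"
  proof (rule cInf_eq_non_empty)
    show "(\<lambda>i. a + f i) ` I \<noteq> {}" using assms by simp
    show "a + (INF i \<in> I. f i) \<le> y" if "y \<in> (\<lambda>i. a + f i) ` I" for y
      using that cINF_lower[OF assms(2)] by auto
    show "y \<le> a + (INF i \<in> I. f i)" if "\<And>z. z \<in> (\<lambda>i. a + f i) ` I \<Longrightarrow> y \<le> z" for y
    proof -
      have "y - a \<le> (INF i \<in> I. f i)"
        using assms(1) that by (intro cINF_greatest) (auto simp: diff_le_eq add.commute)
      then show ?thesis by simp
    qed
  qed
  then show ?thesis using False assms by simp
qed

text \<open>The value of the \<open>\<tau>\<close> stages after \<open>x\<close>, before the next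
  \<open>r\<close> and \<open>u\<close> are chosen; the stopping decision at the successor is
  already inside \<open>Vtau\<close>.\<close>

definition continuation ::
  "real ^ 'm ^ 'm \<Rightarrow> real ^ 'm \<Rightarrow> real set \<Rightarrow> (real ^ 'm \<Rightarrow> real) \<Rightarrow> nat \<Rightarrow> real ^ 'm \<Rightarrow> real" where
  "continuation A B U \<sigma> \<tau> x = (INF r \<in> {-1..1}. MAX u \<in> U. Vtau A B U \<sigma> \<tau> (sys_step A B x r u))"

text \<open>
  The affine form makes the statement stable under \<open>payoff_shift\<close>, so that constants
  never have to be pulled out of infima not yet known to be finite.
\<close>

lemma nested_opt_payoff:
  assumes U: "finite U" "U \<noteq> {}"
    and "b \<in> {0, 1}" "\<theta> 0 \<in> {0, 1}"
  shows "nested_opt U (\<lambda>\<theta> r u. a + b * payoff A B \<sigma> (Suc k) x \<theta> r u) k 0 \<theta> r u =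
    a + b * \<theta> 0 * (\<sigma> x + continuation A B U \<sigma> k x)"
  using assms(3,4)
proof (induction k arbitrary: a b x \<theta> r u)
  case 0
  have "(MAX u \<in> U. (0::real)) = 0" using U by simp
  then have "continuation A B U \<sigma> 0 x = 0"
    by (simp add: continuation_def Vtau_0)
  then show ?case by (simp add: payoff_def algebra_simps)
next
  case (Suc k)
  define w where "w y = \<sigma> y + continuation A B U \<sigma> k y" for y
  \<comment> \<open>The induction hypothesis with \<open>a = 0\<close> and \<open>b = 1\<close>
    yields the Bellman equation for \<open>Suc k\<close> stages, through which
    \<open>continuation\<close> at \<open>Suc k\<close> is evaluated.\<close>
  have V: "Vtau A B U \<sigma> (Suc k) y = max 0 (w y)" for y
  proof -
    have "nested_opt U (payoff A B \<sigma> (Suc k) y) k 0 ((\<lambda>_. 0)(0 := th)) (\<lambda>_. 0) (\<lambda>_. 0) = th * w y"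
      if "th \<in> {0, 1}" for th
      using Suc.IH[of 1 "(\<lambda>_. 0)(0 := th)" 0 y "\<lambda>_. 0" "\<lambda>_. 0"] that
      by (simp add: w_def fun_upd_def)
    then show ?thesis by (simp add: Vtau_def)
  qed
  let ?d = "b * \<theta> 0"
  have d: "?d \<in> {0, 1}" using Suc.prems by auto
  \<comment> \<open>The shift moves the stage payoff into the constant and \<open>\<theta> 0\<close>
    into the factor, so the induction hypothesis applies at the successor state.\<close>
  have step: "nested_opt U (\<lambda>\<theta> r u. a + b * payoff A B \<sigma> (Suc (Suc k)) x \<theta> r u) k (Suc 0)
      (\<theta>(Suc 0 := th)) (r(0 := rn)) (u(0 := un))
    = (a + ?d * \<sigma> x) + ?d * th * w (sys_step A B x rn un)" if "th \<in> {0, 1}" for th rn un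
  proof -
    have "nested_opt U (\<lambda>\<theta> r u. a + b * payoff A B \<sigma> (Suc (Suc k)) x \<theta> r u) k (Suc 0)
      (\<theta>(Suc 0 := th)) (r(0 := rn)) (u(0 := un))
     = nested_opt U (\<lambda>\<theta>' r' u'. (a + ?d * \<sigma> x) +
          ?d * payoff A B \<sigma> (Suc k) (sys_step A B x rn un) \<theta>' r' u') k 0
        (\<lambda>k. (\<theta>(Suc 0 := th)) (Suc k)) (\<lambda>k. (r(0 := rn)) (Suc k)) (\<lambda>k. (u(0 := un)) (Suc k))"
      by (rule nested_opt_shift) (simp add: payoff_shift algebra_simps)
    also have "\<dots> = (a + ?d * \<sigma> x) + ?d * th * w (sys_step A B x rn un)"
      using Suc.IH[OF d] that by (simp add: w_def)
    finally show ?thesis .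
  qed
  have "(MAX (un, th) \<in> U \<times> {0, 1}.
      nested_opt U (\<lambda>\<theta> r u. a + b * payoff A B \<sigma> (Suc (Suc k)) x \<theta> r u) k (Suc 0)
        (\<theta>(Suc 0 := th)) (r(0 := rn)) (u(0 := un)))
    = (MAX (un, th) \<in> U \<times> {0, 1}. (a + ?d * \<sigma> x) + ?d * th * w (sys_step A B x rn un))" for rn
    by (intro arg_cong[where f = Max] image_cong refl) (auto simp only: step insert_iff simp_thms split: prod.splits)
  also have "\<dots> rn = (a + ?d * \<sigma> x) + ?d * (MAX u \<in> U. Vtau A B U \<sigma> (Suc k) (sys_step A B x rn u))"
    for rn
    unfolding V by (rule Max_stopping) (use U d in auto)
  finally have inner: "(MAX (un, th) \<in> U \<times> {0, 1}.
      nested_opt U (\<lambda>\<theta> r u. a + b * payoff A B \<sigma> (Suc (Suc k)) x \<theta> r u) k (Suc 0)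
        (\<theta>(Suc 0 := th)) (r(0 := rn)) (u(0 := un)))
    = (a + ?d * \<sigma> x) + ?d * (MAX u \<in> U. Vtau A B U \<sigma> (Suc k) (sys_step A B x rn u))" for rn .
  \<comment> \<open>Nonnegativity makes the real-valued infimum a genuine greatest lower
    bound.\<close>
  have "(MAX u \<in> U. Vtau A B U \<sigma> (Suc k) (sys_step A B x rn u)) \<ge> 0" for rn
    using U by (auto simp: Max_ge_iff V)
  then have "bdd_below ((\<lambda>rn. MAX u \<in> U. Vtau A B U \<sigma> (Suc k) (sys_step A B x rn u)) ` {-1..1})"
    by (intro bdd_belowI2[of _ 0])
  then have "(INF rn \<in> {-1..1}. (a + ?d * \<sigma> x) +
       ?d * (MAX u \<in> U. Vtau A B U \<sigma> (Suc k) (sys_step A B x rn u)))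
     = (a + ?d * \<sigma> x) + ?d * continuation A B U \<sigma> (Suc k) x"
    unfolding continuation_def by (intro INF_affine) (use d in auto)
  then show ?case by (simp add: inner algebra_simps)
qed

lemma Vtau_Suc:
  assumes "finite U" "U \<noteq> {}"
  shows "Vtau A B U \<sigma> (Suc \<tau>) x = max 0 (\<sigma> x + continuation A B U \<sigma> \<tau> x)"
proof -
  have "nested_opt U (payoff A B \<sigma> (Suc \<tau>) x) \<tau> 0 ((\<lambda>_. 0)(0 := th)) (\<lambda>_. 0) (\<lambda>_. 0)
      = th * (\<sigma> x + continuation A B U \<sigma> \<tau> x)" if "th \<in> {0, 1}" for th
    using nested_opt_payoff[OF assms, of 1 "(\<lambda>_. 0)(0 := th)" 0 A B \<sigma> \<tau> x "\<lambda>_. 0" "\<lambda>_. 0"] that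
    by (simp add: fun_upd_def)
  then show ?thesis by (simp add: Vtau_def)
qed

lemma Vtau_nonneg:
  assumes "finite U" "U \<noteq> {}"
  shows "0 \<le> Vtau A B U \<sigma> \<tau> x"
  by (cases \<tau>) (simp_all add: Vtau_0 Vtau_Suc[OF assms])

text \<open>Fixing one \<open>r\<close> bounds the infimum from above. Strategies of the
  \<open>r\<close>-player enter the later estimates through this inequality.\<close>

lemma Vtau_Suc_le:
  assumes U: "finite U" "U \<noteq> {}" and r: "r \<in> {-1..1}"
    and le: "\<And>u. u \<in> U \<Longrightarrow> Vtau A B U \<sigma> \<tau> (sys_step A B x r u) \<le> D"
  shows "Vtau A B U \<sigma> (Suc \<tau>) x \<le> max 0 (\<sigma> x + D)"
proof -
  have "continuation A B U \<sigma> \<tau> x \<le> (MAX u \<in> U. Vtau A B U \<sigma> \<tau> (sys_step A B x r u))"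
    unfolding continuation_def
  proof (rule cINF_lower[OF bdd_belowI2[of _ 0] r])
    show "0 \<le> (MAX u \<in> U. Vtau A B U \<sigma> \<tau> (sys_step A B x r u))" for r
      using U by (auto simp: Max_ge_iff Vtau_nonneg)
  qed
  also have "\<dots> \<le> D" using U le by simp
  finally show ?thesis by (simp add: Vtau_Suc[OF U] max.coboundedI2)
qed

section \<open>Local boundedness of the value function\<close>

text \<open>An input sequence \<open>r\<close> fixed in advance is followed for \<open>N\<close>
  steps. Each use of \<open>step\<close> adds at most \<open>C\<close>, and nonnegativity of
  \<open>C\<close> and \<open>D\<close> absorbs the maximum with 0.\<close>

lemma value_le_steering:
  fixes V :: "real ^ 'm \<Rightarrow> real"
  assumes step: "\<And>x r D. r \<in> {-1..1} \<Longrightarrow> (\<And>u. u \<in> U \<Longrightarrow> V (sys_step A B x r u) \<le> D) \<Longrightarrow>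
      V x \<le> max 0 (\<sigma> x + D)"
    and U: "U \<noteq> {}" and "0 \<le> C" "0 \<le> D" and "\<And>k. r k \<in> {-1..1}"
    and "\<And>u n. (\<And>k. u k \<in> U) \<Longrightarrow> n < N \<Longrightarrow> \<bar>\<sigma> (traj A B y r u n)\<bar> \<le> C"
    and "\<And>u. (\<And>k. u k \<in> U) \<Longrightarrow> V (traj A B y r u N) \<le> D"
  shows "V y \<le> real N * C + D"
  using assms(5-7)
proof (induction N arbitrary: y r)
  case 0
  obtain u0 where "u0 \<in> U" using U by blast
  then show ?case using "0.prems"(3)[of "\<lambda>_. u0"] by simp
next
  case (Suc N)
  obtain u0 where u0: "u0 \<in> U" using U by blast
  have "V (sys_step A B y (r 0) u) \<le> real N * C + D" if u: "u \<in> U" for u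
  proof (rule Suc.IH)
    show "r (Suc k) \<in> {-1..1}" for k by (rule Suc.prems)
  next
    fix u' :: "nat \<Rightarrow> real" and n assume u': "\<And>k. u' k \<in> U" and "n < N"
    \<comment> \<open>Prepending \<open>u\<close> turns a run from the successor into a run from
      \<open>y\<close>, to which the hypotheses apply.\<close>
    have "case_nat u u' k \<in> U" for k using u u' by (cases k) auto
    from Suc.prems(2)[of "case_nat u u'", OF this, of "Suc n"] \<open>n < N\<close>
    show "\<bar>\<sigma> (traj A B (sys_step A B y (r 0) u) (\<lambda>k. r (Suc k)) u' n)\<bar> \<le> C"
      by (simp add: traj_shift del: traj.simps)
  next
    fix u' :: "nat \<Rightarrow> real" assume u': "\<And>k. u' k \<in> U"
    have "case_nat u u' k \<in> U" for k using u u' by (cases k) auto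
    from Suc.prems(3)[of "case_nat u u'", OF this]
    show "V (traj A B (sys_step A B y (r 0) u) (\<lambda>k. r (Suc k)) u' N) \<le> D"
      by (simp add: traj_shift del: traj.simps)
  qed
  from step[OF Suc.prems(1) this] have "V y \<le> max 0 (\<sigma> y + (real N * C + D))" by blast
  moreover have "\<bar>\<sigma> y\<bar> \<le> C" using Suc.prems(2)[of "\<lambda>_. u0" 0] u0 by simp
  moreover have "0 \<le> real N * C" using \<open>0 \<le> C\<close> by simp
  moreover have "real (Suc N) * C = real N * C + C" by (simp add: algebra_simps)
  ultimately show ?case using \<open>0 \<le> D\<close> \<open>0 \<le> C\<close> by linarith
qed

text \<open>Both runs face the same \<open>u\<close>, which cancels. This leaves the variation of
  constants formula for a linear system driven by \<open>r\<close>.\<close>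

lemma traj_diff:
  "traj A B y r u n - traj A B x (\<lambda>_. 0) u n =
     (((*v) A) ^^ n) (y - x) + (\<Sum>k<n. r (n - 1 - k) *\<^sub>R (((*v) A) ^^ k) B)"
proof (induction n)
  case 0
  then show ?case by simp
next
  case (Suc n)
  have "traj A B y r u (Suc n) - traj A B x (\<lambda>_. 0) u (Suc n) =
      A *v (traj A B y r u n - traj A B x (\<lambda>_. 0) u n) + r n *\<^sub>R B"
    by (simp add: sys_step_def matrix_vector_mult_diff_distrib)
  also have "\<dots> = (((*v) A) ^^ Suc n) (y - x) +
      ((\<Sum>k<n. r (n - 1 - k) *\<^sub>R (((*v) A) ^^ Suc k) B) + r n *\<^sub>R B)"
    by (simp add: Suc.IH matrix_vector_right_distrib matrix_vector_mult_scaleR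
        linear_sum[OF matrix_vector_mul_linear])
  also have "(\<Sum>k<n. r (n - 1 - k) *\<^sub>R (((*v) A) ^^ Suc k) B) + r n *\<^sub>R B =
      (\<Sum>k<Suc n. r (Suc n - 1 - k) *\<^sub>R (((*v) A) ^^ k) B)"
    by (subst sum.lessThan_Suc_shift) simp
  finally show ?case .
qed

lemma finite_traj:
  assumes "finite U"
  shows "finite {traj A B x r u n | u. \<forall>k. u k \<in> U}"
proof (induction n)
  case 0
  have "{traj A B x r u 0 | u. \<forall>k. u k \<in> U} \<subseteq> {x}" by auto
  then show ?case by (rule finite_subset) simp
next
  case (Suc n)
  have "{traj A B x r u (Suc n) | u. \<forall>k. u k \<in> U} \<subseteq>
      (\<lambda>(z, v). sys_step A B z (r n) v) ` ({traj A B x r u n | u. \<forall>k. u k \<in> U} \<times> U)"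
    by force
  then show ?case using Suc assms by (meson finite_SigmaI finite_imageI finite_subset)
qed

lemma norm_sys_step_input_le:
  assumes "r \<in> {-1..1}" "\<bar>u\<bar> \<le> c"
  shows "norm (r *\<^sub>R B - u *\<^sub>R B) \<le> (1 + c) * norm (B :: real ^ 'm)"
proof -
  have "norm (r *\<^sub>R B - u *\<^sub>R B) = \<bar>r - u\<bar> * norm B"
    by (simp flip: scaleR_left_diff_distrib)
  also have "\<dots> \<le> (1 + c) * norm B"
    using assms by (intro mult_right_mono) auto
  finally show ?thesis .
qed

lemma traj_bounded:
  fixes A :: "real ^ 'm ^ 'm"
  assumes "bounded U"
  shows "\<exists>C. \<forall>y r u. norm y \<le> R \<longrightarrow> (\<forall>k. r k \<in> {-1..1}) \<longrightarrow> (\<forall>k. u k \<in> U) \<longrightarrow>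
    norm (traj A B y r u n) \<le> C"
proof (induction n)
  case 0
  then show ?case by auto
next
  case (Suc n)
  then obtain C where C: "\<And>y r u. norm y \<le> R \<Longrightarrow> (\<forall>k. r k \<in> {-1..1}) \<Longrightarrow> (\<forall>k. u k \<in> U) \<Longrightarrow>
    norm (traj A B y r u n) \<le> C" by blast
  obtain c where c: "\<And>u. u \<in> U \<Longrightarrow> \<bar>u\<bar> \<le> c" using assms by (auto simp: bounded_real)
  show ?case
  proof (intro exI allI impI)
    fix y :: "real ^ 'm" and r u :: "nat \<Rightarrow> real"
    assume *: "norm y \<le> R" "\<forall>k. r k \<in> {-1..1}" "\<forall>k. u k \<in> U"
    let ?z = "traj A B y r u n"
    have "norm (traj A B y r u (Suc n)) \<le> norm (A *v ?z) + norm (r n *\<^sub>R B - u n *\<^sub>R B)"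
      using norm_triangle_ineq[of "A *v ?z" "r n *\<^sub>R B - u n *\<^sub>R B"] by (simp add: sys_step_def algebra_simps)
    also have "\<dots> \<le> onorm ((*v) A) * norm ?z + (1 + c) * norm B"
      using * c by (intro add_mono norm_sys_step_input_le onorm matrix_vector_mul_bounded_linear) auto
    also have "\<dots> \<le> onorm ((*v) A) * C + (1 + c) * norm B"
      using C[OF *] by (intro add_right_mono mult_left_mono onorm_pos_le matrix_vector_mul_bounded_linear) auto
    finally show "norm (traj A B y r u (Suc n)) \<le> onorm ((*v) A) * C + (1 + c) * norm B" .
  qed
qed

text \<open>Expanding the standard basis vectors once and extending linearly gives coefficients that
  depend linearly, hence boundedly, on \<open>w\<close>.\<close>

lemma small_coefficients:
  fixes v :: "nat \<Rightarrow> 'a::euclidean_space"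
  assumes inj: "inj_on v {..<n}" and span: "span (v ` {..<n}) = UNIV"
  shows "\<exists>C\<ge>0. \<forall>w. \<exists>c. w = (\<Sum>k<n. c k *\<^sub>R v k) \<and> (\<forall>k. \<bar>c k\<bar> \<le> C * norm w)"
proof -
  have "\<exists>c. b = (\<Sum>k<n. c k *\<^sub>R v k)" for b
  proof -
    have "b \<in> span (v ` {..<n})" using span by simp
    then obtain u where "b = (\<Sum>x \<in> v ` {..<n}. u x *\<^sub>R x)"
      by (auto simp: span_finite)
    then have "b = (\<Sum>k<n. u (v k) *\<^sub>R v k)"
      using inj by (simp add: sum.reindex)
    then show ?thesis by (rule exI[of _ "\<lambda>k. u (v k)"])
  qed
  then obtain c where c: "\<And>b. b = (\<Sum>k<n. c b k *\<^sub>R v k)" by metis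
  define C where "C = (\<Sum>b\<in>Basis. \<Sum>k<n. \<bar>c b k\<bar>)"
  show ?thesis
  proof (intro exI[of _ C] conjI allI)
    show "0 \<le> C" by (simp add: C_def sum_nonneg)
    fix w :: 'a
    \<comment> \<open>The value 0 beyond the index range lets the bound hold for all
      \<open>k\<close>.\<close>
    define d where "d k = (if k < n then \<Sum>b\<in>Basis. (w \<bullet> b) * c b k else 0)" for k
    have "w = (\<Sum>b\<in>Basis. (w \<bullet> b) *\<^sub>R (\<Sum>k<n. c b k *\<^sub>R v k))"
      by (subst c[symmetric]) (simp add: euclidean_representation)
    also have "\<dots> = (\<Sum>b\<in>Basis. \<Sum>k<n. ((w \<bullet> b) * c b k) *\<^sub>R v k)"
      by (simp add: scaleR_sum_right)
    also have "\<dots> = (\<Sum>k<n. \<Sum>b\<in>Basis. ((w \<bullet> b) * c b k) *\<^sub>R v k)"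
      by (rule sum.swap)
    also have "\<dots> = (\<Sum>k<n. d k *\<^sub>R v k)"
      by (simp add: d_def scaleR_sum_left)
    finally have "w = (\<Sum>k<n. d k *\<^sub>R v k)" .
    moreover have "\<bar>d k\<bar> \<le> C * norm w" for k
    proof (cases "k < n")
      case True
      have "\<bar>d k\<bar> \<le> (\<Sum>b\<in>Basis. \<bar>(w \<bullet> b) * c b k\<bar>)"
        using True by (simp add: d_def)
      also have "\<dots> \<le> (\<Sum>b\<in>Basis. norm w * (\<Sum>k<n. \<bar>c b k\<bar>))"
        unfolding abs_mult using True
        by (intro sum_mono mult_mono Basis_le_norm member_le_sum) auto
      also have "\<dots> = C * norm w"
        by (simp add: C_def sum_distrib_left mult.commute)
      finally show ?thesis .
    next
      case False
      then show ?thesis using \<open>0 \<le> C\<close> by (simp add: d_def)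
    qed
    ultimately show "\<exists>c. w = (\<Sum>k<n. c k *\<^sub>R v k) \<and> (\<forall>k. \<bar>c k\<bar> \<le> C * norm w)" by blast
  qed
qed

text \<open>Rank \<open>CARD('m)\<close> attained by \<open>CARD('m)\<close> vectors forces them
  both to span and to be distinct.\<close>

lemma controllable_coefficients:
  fixes A :: "real ^ 'm ^ 'm"
  assumes "controllable A B"
  shows "\<exists>C\<ge>0. \<forall>w. \<exists>c. w = (\<Sum>k<CARD('m). c k *\<^sub>R (((*v) A) ^^ k) B) \<and> (\<forall>k. \<bar>c k\<bar> \<le> C * norm w)"
proof (rule small_coefficients)
  let ?v = "\<lambda>k. (((*v) A) ^^ k) B" and ?n = "CARD('m)"
  have "{?v k | k. k < ?n} = ?v ` {..<?n}" by auto
  then have dim: "dim (?v ` {..<?n}) = ?n" using assms by (simp add: controllable_def)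
  then show "span (?v ` {..<?n}) = UNIV" by (simp flip: dim_eq_full)
  have "dim (?v ` {..<?n}) \<le> card (?v ` {..<?n})" by (intro dim_le_card') auto
  moreover have "card (?v ` {..<?n}) \<le> card {..<?n}" by (intro card_image_le) auto
  ultimately show "inj_on ?v {..<?n}" using dim by (intro eq_card_imp_inj_on) auto
qed

text \<open>
  From any \<open>y\<close> close to \<open>x\<close> the \<open>r\<close>-player can, whatever the \<open>u\<close>-player does, cancel the
  difference \<open>y - x\<close> within \<open>CARD('m)\<close> steps and thus land in the finite set of states that are
  reachable from \<open>x\<close> under \<open>r = 0\<close>.
\<close>

lemma value_locally_bounded:
  fixes V :: "real ^ 'm \<Rightarrow> real"
  assumes step: "\<And>x r D. r \<in> {-1..1} \<Longrightarrow> (\<And>u. u \<in> U \<Longrightarrow> V (sys_step A B x r u) \<le> D) \<Longrightarrow>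
      V x \<le> max 0 (\<sigma> x + D)"
    and U: "finite U" "U \<noteq> {}" and ctrl: "controllable A B" and "BIBO \<sigma>"
  shows "\<exists>\<delta>>0. \<exists>D. \<forall>y \<in> ball x \<delta>. V y \<le> D"
proof -
  let ?n = "CARD('m)" and ?P = "((*v) A) ^^ CARD('m)"
  obtain C where C: "C \<ge> 0" "\<And>w. \<exists>c. w = (\<Sum>k<?n. c k *\<^sub>R (((*v) A) ^^ k) B) \<and> (\<forall>k. \<bar>c k\<bar> \<le> C * norm w)"
    using controllable_coefficients[OF ctrl] by blast
  have lin: "bounded_linear (((*v) A) ^^ k)" for k
  proof (induction k)
    case 0
    then show ?case by (simp add: id_def)
  next
    case (Suc k)
    from bounded_linear_compose[OF matrix_vector_mul_bounded_linear[of A] this]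
    show ?case by (simp add: comp_def)
  qed
  obtain L where L: "L > 0" "\<And>z. norm (?P z) \<le> norm z * L"
    using bounded_linear.pos_bounded[OF lin] by blast
  \<comment> \<open>The first bound keeps \<open>y\<close> within norm \<open>norm x + 1\<close>;
    the second makes the steering coefficients at most 1 in absolute value, hence admissible
    inputs.\<close>
  define \<delta> where "\<delta> = min 1 (1 / (C * L + 1))"
  have CL: "C * L \<ge> 0" using C L by simp
  then have "\<delta> > 0" by (simp add: \<delta>_def add_nonneg_pos)
  have "bounded U" using U by (simp add: finite_imp_bounded)
  then have "\<forall>n. \<exists>E. \<forall>y r u. norm y \<le> norm x + 1 \<longrightarrow> (\<forall>k. r k \<in> {-1..1}) \<longrightarrow> (\<forall>k. u k \<in> U) \<longrightarrow>
    norm (traj A B y r u n) \<le> E" using traj_bounded by blast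
  then obtain E where E: "\<And>n y r u. norm y \<le> norm x + 1 \<Longrightarrow> (\<forall>k. r k \<in> {-1..1}) \<Longrightarrow> (\<forall>k. u k \<in> U) \<Longrightarrow>
    norm (traj A B y r u n) \<le> E n" by metis
  have "bounded (\<Union>n<?n. cball (0 :: real ^ 'm) (E n))" by (intro bounded_UN) auto
  then have "bounded (\<sigma> ` (\<Union>n<?n. cball 0 (E n)))"
    using \<open>BIBO \<sigma>\<close> by (simp add: BIBO_def)
  then obtain S where "\<And>z. z \<in> (\<Union>n<?n. cball 0 (E n)) \<Longrightarrow> \<bar>\<sigma> z\<bar> \<le> S"
    unfolding bounded_real by (metis imageI)
  then have S: "\<bar>\<sigma> z\<bar> \<le> max 0 S" if "n < ?n" "norm z \<le> E n" for z n
    using that by (force simp: le_max_iff_disj)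
  have "finite (V ` {traj A B x (\<lambda>_. 0) u ?n | u. \<forall>k. u k \<in> U})"
    using finite_traj[OF U(1)] by blast
  then have "bdd_above (V ` {traj A B x (\<lambda>_. 0) u ?n | u. \<forall>k. u k \<in> U})" by (rule bdd_above_finite)
  then obtain D where D: "V (traj A B x (\<lambda>_. 0) u ?n) \<le> D" if "\<And>k. u k \<in> U" for u
    by (auto simp: bdd_above_def)
  have "V y \<le> real ?n * max 0 S + max 0 D" if y: "y \<in> ball x \<delta>" for y
  proof -
    have ny: "norm (y - x) < \<delta>" using y by (simp add: dist_norm norm_minus_commute)
    \<comment> \<open>The inputs have to produce the negative of the free evolution of
      \<open>y - x\<close>.\<close>
    obtain c where c: "- ?P (y - x) = (\<Sum>k<?n. c k *\<^sub>R (((*v) A) ^^ k) B)"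
      "\<And>k. \<bar>c k\<bar> \<le> C * norm (?P (y - x))"
      using C(2)[of "- ?P (y - x)"] by auto
    \<comment> \<open>Time is reversed because the \<open>k\<close>-th power of \<open>A\<close>
      acts on the input of time \<open>?n - 1 - k\<close>.\<close>
    define r where "r k = c (?n - 1 - k)" for k
    have "\<bar>c k\<bar> \<le> 1" for k
    proof -
      have "\<bar>c k\<bar> \<le> C * (norm (y - x) * L)"
        using c(2)[of k] mult_left_mono[OF L(2) C(1)] by (rule order_trans)
      also have "\<dots> = (C * L) * norm (y - x)" by simp
      also have "\<dots> \<le> (C * L) * (1 / (C * L + 1))"
        using CL ny by (intro mult_left_mono) (auto simp: \<delta>_def)
      also have "\<dots> \<le> 1" using CL by simp
      finally show ?thesis .
    qed
    then have r: "r k \<in> {-1..1}" for k by (auto simp: r_def abs_le_iff minus_le_iff)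
    have "(\<Sum>k<?n. r (?n - 1 - k) *\<^sub>R (((*v) A) ^^ k) B) = - ?P (y - x)"
      unfolding c(1) by (intro sum.cong) (auto simp: r_def)
    then have meet: "traj A B y r u ?n = traj A B x (\<lambda>_. 0) u ?n" for u
      using traj_diff[of A B y r u ?n x] by simp
    have "norm y \<le> norm x + 1"
      using ny norm_triangle_sub[of y x] by (simp add: \<delta>_def)
    show ?thesis
    proof (rule value_le_steering[OF _ U(2)])
      show "V x \<le> max 0 (\<sigma> x + D)"
        if "r \<in> {-1..1}" "\<And>u. u \<in> U \<Longrightarrow> V (sys_step A B x r u) \<le> D" for x r D
        using that by (rule step)
      show "r k \<in> {-1..1}" for k by (rule r)
      show "\<bar>\<sigma> (traj A B y r u n)\<bar> \<le> max 0 S" if "\<And>k. u k \<in> U" "n < ?n" for u n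
        using S[OF that(2)] E[of y r u n] that(1) r \<open>norm y \<le> norm x + 1\<close> by blast
      show "V (traj A B y r u ?n) \<le> max 0 D" if "\<And>k. u k \<in> U" for u
        using D[OF that] by (simp add: meet le_max_iff_disj)
    qed auto
  qed
  then show ?thesis using \<open>\<delta> > 0\<close> by blast
qed

lemma locally_bounded_imp_bounded_on_compact:
  fixes f :: "'a::metric_space \<Rightarrow> real"
  assumes "compact S" and "\<And>x. \<exists>\<delta>>0. \<exists>D. \<forall>y \<in> ball x \<delta>. f y \<le> D"
  shows "\<exists>D. \<forall>y \<in> S. f y \<le> D"
proof -
  obtain d D where d: "\<And>x. d x > 0" "\<And>x y. y \<in> ball x (d x) \<Longrightarrow> f y \<le> D x"
    using assms(2) by metis
  have "S \<subseteq> (\<Union>x\<in>S. ball x (d x))" using d(1) by auto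
  then obtain T where T: "T \<subseteq> S" "finite T" "S \<subseteq> (\<Union>x\<in>T. ball x (d x))"
    using compactE_image[OF assms(1), of S "\<lambda>x. ball x (d x)"] open_ball by metis
  have "bdd_above (D ` T)" using T by simp
  then obtain M where "\<And>x. x \<in> T \<Longrightarrow> D x \<le> M" by (auto simp: bdd_above_def)
  moreover have "\<exists>x\<in>T. f y \<le> D x" if "y \<in> S" for y
    using that T(3) d(2) by blast
  ultimately have "f y \<le> M" if "y \<in> S" for y
    using that order_trans by blast
  then show ?thesis by blast
qed

section \<open>Motion inside the cylinder\<close>

text \<open>A nonzero coordinate of the real vector \<open>e\<close> exhibits \<open>\<mu>\<close>
  as a quotient of real numbers; modulus 1 then leaves only the two signs.\<close>

lemma real_eigenvector_unimodular:
  assumes "is_eigenvector (map_matrix complex_of_real A) \<mu> (cvec e)" and "cmod \<mu> = 1"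
  shows "\<exists>s. \<bar>s\<bar> = 1 \<and> A *v e = s *\<^sub>R e"
proof -
  have eq: "complex_of_real ((A *v e) $ i) = \<mu> * complex_of_real (e $ i)" for i
  proof -
    have "(map_matrix complex_of_real A *v cvec e) $ i = (\<mu> *s cvec e) $ i"
      using assms by (simp add: is_eigenvector_def)
    then show ?thesis
      by (simp add: matrix_vector_mult_def map_matrix_def cvec_def)
  qed
  have "cvec e \<noteq> 0" using assms by (simp add: is_eigenvector_def)
  then obtain j where j: "e $ j \<noteq> 0" by (auto simp: cvec_def vec_eq_iff)
  define s where "s = (A *v e) $ j / e $ j"
  have \<mu>: "\<mu> = complex_of_real s" using eq[of j] j by (simp add: s_def field_simps)
  have "(A *v e) $ i = s * e $ i" for i
    using eq[of i] unfolding \<mu> by (metis of_real_eq_iff of_real_mult)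
  then have "A *v e = s *\<^sub>R e" by (simp add: vec_eq_iff)
  moreover have "\<bar>s\<bar> = 1" using assms(2) \<mu> by simp
  ultimately show ?thesis by blast
qed

text \<open>The minimum of the form on the compact unit sphere is positive and extends to all
  vectors by homogeneity of degree two.\<close>

lemma sym_pos_def_lower_bound:
  fixes Q :: "real ^ 'm ^ 'm"
  assumes "sym_pos_def Q"
  shows "\<exists>c>0. \<forall>x. c * (norm x)\<^sup>2 \<le> x \<bullet> (Q *v x)"
proof -
  let ?q = "\<lambda>x. x \<bullet> (Q *v x)"
  have "continuous_on (sphere 0 1) ?q"
    by (intro continuous_on_inner continuous_on_id linear_continuous_on
        matrix_vector_mul_bounded_linear)
  moreover have "sphere (0 :: real ^ 'm) 1 \<noteq> {}" by simp
  ultimately obtain z where z: "z \<in> sphere 0 1" "\<And>x. x \<in> sphere 0 1 \<Longrightarrow> ?q z \<le> ?q x"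
    using continuous_attains_inf[of "sphere 0 1" ?q] by auto
  have "?q z * (norm x)\<^sup>2 \<le> ?q x" for x
  proof (cases "x = 0")
    case False
    have "?q x = ?q (x /\<^sub>R norm x) * (norm x)\<^sup>2"
      using False by (simp add: matrix_vector_mult_scaleR power2_eq_square field_simps)
    moreover have "?q z \<le> ?q (x /\<^sub>R norm x)" using False by (intro z) simp
    ultimately show ?thesis by (simp add: mult_right_mono)
  qed simp
  moreover have "z \<noteq> 0" using z(1) by auto
  then have "?q z > 0" using assms by (simp add: sym_pos_def_def)
  ultimately show ?thesis by blast
qed

lemma cylinder_near_axis:
  fixes Q :: "real ^ 'm ^ 'm"
  assumes "sym_pos_def Q"
  shows "\<exists>\<rho>\<ge>0. \<forall>x \<in> cylinder Q \<beta> e. \<exists>t. norm (x - t *\<^sub>R e) \<le> \<rho>"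
proof -
  obtain c where c: "c > 0" "\<And>x. c * (norm x)\<^sup>2 \<le> x \<bullet> (Q *v x)"
    using sym_pos_def_lower_bound[OF assms] by blast
  \<comment> \<open>The slack 1 yields a parameter \<open>t\<close> strictly below the bound without
    computing a minimizer. The absolute value keeps the radius nonnegative for any sign of
    \<open>\<beta>\<close>.\<close>
  have "\<exists>t. norm (x - t *\<^sub>R e) \<le> sqrt \<bar>(\<beta> + 1) / c\<bar>" if "x \<in> cylinder Q \<beta> e" for x
  proof -
    let ?q = "\<lambda>t. (x - t *\<^sub>R e) \<bullet> (Q *v (x - t *\<^sub>R e))"
    have "(INF t. ?q t) < \<beta> + 1" using that by (simp add: cylinder_def)
    moreover have "0 \<le> ?q t" for t
      using c(1) by (intro order_trans[OF _ c(2)]) simp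
    then have "bdd_below (range ?q)" by (intro bdd_belowI2[of _ 0])
    ultimately obtain t where "?q t < \<beta> + 1" by (auto simp: cINF_less_iff)
    then have "c * (norm (x - t *\<^sub>R e))\<^sup>2 \<le> \<beta> + 1" using c(2)[of "x - t *\<^sub>R e"] by linarith
    then have "(norm (x - t *\<^sub>R e))\<^sup>2 \<le> \<bar>(\<beta> + 1) / c\<bar>"
      using c(1) by (intro order_trans[OF _ abs_ge_self]) (simp add: pos_le_divide_eq mult.commute)
    then have "norm (x - t *\<^sub>R e) \<le> sqrt \<bar>(\<beta> + 1) / c\<bar>" by (rule real_le_rsqrt)
    then show ?thesis by blast
  qed
  then show ?thesis by (intro exI[of _ "sqrt \<bar>(\<beta> + 1) / c\<bar>"]) auto
qed

text \<open>On the axis the state only changes sign, so within the cylinder it moves at bounded speed.\<close>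

lemma sys_step_norm_decrease:
  fixes A :: "real ^ 'm ^ 'm"
  assumes s: "\<bar>s\<bar> = 1" "A *v e = s *\<^sub>R e" and Q: "sym_pos_def Q" and "bounded U"
  shows "\<exists>K>0. \<forall>x \<in> cylinder Q \<beta> e. \<forall>r \<in> {-1..1}. \<forall>u \<in> U. norm x - K \<le> norm (sys_step A B x r u)"
proof -
  obtain \<rho> where \<rho>: "\<rho> \<ge> 0" "\<And>x. x \<in> cylinder Q \<beta> e \<Longrightarrow> \<exists>t. norm (x - t *\<^sub>R e) \<le> \<rho>"
    using cylinder_near_axis[OF Q] by metis
  obtain c where c: "\<And>u. u \<in> U \<Longrightarrow> \<bar>u\<bar> \<le> c" using \<open>bounded U\<close> by (auto simp: bounded_real)
  define K where "K = onorm ((*v) A) * \<rho> + \<rho> + (1 + c) * norm B"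
  have "norm x - K \<le> norm (sys_step A B x r u)"
    if x: "x \<in> cylinder Q \<beta> e" and r: "r \<in> {-1..1}" and u: "u \<in> U" for x r u
  proof -
    obtain t where t: "norm (x - t *\<^sub>R e) \<le> \<rho>" using \<rho>(2)[OF x] by blast
    define w where "w = x - t *\<^sub>R e"
    let ?g = "r *\<^sub>R B - u *\<^sub>R B"
    have xw: "x = t *\<^sub>R e + w" by (simp add: w_def)
    \<comment> \<open>Since \<open>A\<close> acts as \<open>s\<close> on the axis, the deviation
      from \<open>s *\<^sub>R x\<close> involves only the bounded transversal part \<open>w\<close>
      and the input.\<close>
    have "sys_step A B x r u = s *\<^sub>R x + (A *v w - s *\<^sub>R w + ?g)"
      unfolding sys_step_def xw
      by (simp add: s(2) algebra_simps)
    then have "s *\<^sub>R x = sys_step A B x r u - (A *v w - s *\<^sub>R w + ?g)" by simp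
    then have "norm (s *\<^sub>R x) \<le> norm (sys_step A B x r u) + norm (A *v w - s *\<^sub>R w + ?g)"
      by (metis norm_triangle_ineq4)
    moreover have "norm (A *v w - s *\<^sub>R w + ?g) \<le> norm (A *v w) + norm (s *\<^sub>R w) + norm ?g"
      by (meson add_right_mono norm_triangle_ineq norm_triangle_ineq4 order_trans)
    moreover have "norm (A *v w) \<le> onorm ((*v) A) * \<rho>"
      using t onorm[OF matrix_vector_mul_bounded_linear[of A], of w]
        mult_left_mono[OF t onorm_pos_le[OF matrix_vector_mul_bounded_linear[of A]]]
      by (simp add: w_def)
    moreover have "norm ?g \<le> (1 + c) * norm B"
      using r u c by (intro norm_sys_step_input_le) auto
    ultimately show ?thesis using s t by (simp add: K_def w_def)
  qed
  then show ?thesis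
    \<comment> \<open>The maximum with 1 ensures positivity, since the constant later serves as a
      divisor.\<close>
    by (intro exI[of _ "max 1 K"]) (force simp: max_def)
qed

section \<open>Decay of the value along the cylinder and boundedness of its support\<close>

theorem theorem2:
  fixes A :: "real ^ 'm ^ 'm"
    and B :: "real ^ 'm"
    and U :: "real set"
    and \<mu> :: complex
    and e\<^sub>1 :: "real ^ 'm"
    and Q :: "real ^ 'm ^ 'm"
    and \<beta> :: real
    and \<sigma> :: "real ^ 'm \<Rightarrow> real"
    and V :: "real ^ 'm \<Rightarrow> real"
  assumes "finite U" and "U \<noteq> {}"
    and "controllable A B"
    and "{z. is_eigenvalue (map_matrix complex_of_real A) z \<and> cmod z = 1} = {\<mu>}"
    and "is_eigenvector (map_matrix complex_of_real A) \<mu> (cvec e\<^sub>1)"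
    and "\<beta> > 0" and "sym_pos_def Q"
    and "invariant_cylinder A B U Q \<beta> e\<^sub>1"
    and "BIBO \<sigma>"
    and "\<And>x. bdd_above (range (\<lambda>\<tau>. Vtau A B U \<sigma> \<tau> x))"
    and "\<And>x. V x = (SUP \<tau>. Vtau A B U \<sigma> \<tau> x)"
    and "\<exists>\<epsilon>\<^sub>0 > 0. bounded {x \<in> cylinder Q \<beta> e\<^sub>1. \<sigma> x > - \<epsilon>\<^sub>0}"
  shows "bounded {x \<in> cylinder Q \<beta> e\<^sub>1. V x \<noteq> 0}"
proof -
  note U = assms(1,2)
  have bU: "bounded U" using U by (simp add: finite_imp_bounded)
  have VtauV: "Vtau A B U \<sigma> \<tau> x \<le> V x" for \<tau> x
    unfolding assms(11) by (rule cSUP_upper[OF UNIV_I assms(10)])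
  have Vle: "V x \<le> D" if "\<And>\<tau>. Vtau A B U \<sigma> \<tau> x \<le> D" for x D
    unfolding assms(11) using that by (intro cSUP_least) auto
  have Vnn: "0 \<le> V x" for x using VtauV[of 0 x] by (simp add: Vtau_0)
  \<comment> \<open>The same \<open>r\<close> serves every horizon, so the one-step estimate
    survives the supremum.\<close>
  have step: "V x \<le> max 0 (\<sigma> x + D)"
    if "r \<in> {-1..1}" "\<And>u. u \<in> U \<Longrightarrow> V (sys_step A B x r u) \<le> D" for x r D
  proof (rule Vle)
    show "Vtau A B U \<sigma> \<tau> x \<le> max 0 (\<sigma> x + D)" for \<tau>
      by (cases \<tau>)
        (use that in \<open>auto simp: Vtau_0 intro!: Vtau_Suc_le[OF U] intro: order_trans[OF VtauV]\<close>)
  qed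
  have "\<mu> \<in> {z. is_eigenvalue (map_matrix complex_of_real A) z \<and> cmod z = 1}"
    using assms(4) by simp
  then have "cmod \<mu> = 1" by simp
  then obtain s where s: "\<bar>s\<bar> = 1" "A *v e\<^sub>1 = s *\<^sub>R e\<^sub>1"
    using real_eigenvector_unimodular[OF assms(5)] by blast
  obtain K where K: "K > 0" "\<And>x r u. x \<in> cylinder Q \<beta> e\<^sub>1 \<Longrightarrow> r \<in> {-1..1} \<Longrightarrow> u \<in> U \<Longrightarrow>
      norm x - K \<le> norm (sys_step A B x r u)"
    using sys_step_norm_decrease[OF s assms(7) bU, of \<beta> B] by blast
  obtain \<epsilon> where \<epsilon>: "\<epsilon> > 0" "bounded {x \<in> cylinder Q \<beta> e\<^sub>1. \<sigma> x > - \<epsilon>}"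
    using assms(12) by blast
  obtain R where "\<And>x. x \<in> cylinder Q \<beta> e\<^sub>1 \<Longrightarrow> \<sigma> x > - \<epsilon> \<Longrightarrow> norm x \<le> R"
    using \<epsilon>(2) by (auto simp: bounded_iff)
  then have R: "\<sigma> x \<le> - \<epsilon>" if "x \<in> cylinder Q \<beta> e\<^sub>1" "norm x > R" for x
    using that by force
  have "\<exists>M. \<forall>y \<in> cball 0 R. V y \<le> M"
    by (intro locally_bounded_imp_bounded_on_compact compact_cball
        value_locally_bounded[OF step U assms(3) assms(9)])
  then obtain M where M: "\<And>y. norm y \<le> R \<Longrightarrow> V y \<le> M"
    by (metis mem_cball_0)
  \<comment> \<open>Reaching the ball takes at least \<open>(norm x - R) / K\<close> steps, each
    costing at least \<open>\<epsilon>\<close>, and at most \<open>M\<close> can be gained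
    afterwards.\<close>
  define b where "b x = max 0 (M - \<epsilon> * ((norm x - R) / K))" for x :: "real ^ 'm"
  \<comment> \<open>The estimate is proved for finite horizons, where induction is available, and
    passes to \<open>V\<close> at the end.\<close>
  have decay: "Vtau A B U \<sigma> \<tau> x \<le> b x" if "x \<in> cylinder Q \<beta> e\<^sub>1" "norm x > R" for \<tau> x
    using that
  proof (induction \<tau> arbitrary: x)
    case 0
    then show ?case by (simp add: Vtau_0 b_def)
  next
    case (Suc \<tau>)
    \<comment> \<open>This is the bound at distance \<open>K\<close> closer to the ball, hence
      larger by \<open>\<epsilon>\<close>. The input 0 is a sample choice; the speed bound holds for
      every admissible one.\<close>
    let ?D = "max 0 (M - \<epsilon> * ((norm x - R) / K) + \<epsilon>)"
    have "Vtau A B U \<sigma> \<tau> (sys_step A B x 0 u) \<le> ?D" if u: "u \<in> U" for u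
    proof -
      let ?y = "sys_step A B x 0 u"
      have y: "?y \<in> cylinder Q \<beta> e\<^sub>1"
        using assms(8) Suc.prems u by (auto simp: invariant_cylinder_def)
      have ny: "norm x - K \<le> norm ?y" using K(2)[OF Suc.prems(1) _ u, of 0] by simp
      show ?thesis
      proof (cases "norm ?y > R")
        case True
        have "(norm x - R) / K - 1 = (norm x - K - R) / K"
          using K(1) by (simp add: field_simps)
        also have "\<dots> \<le> (norm ?y - R) / K"
          using ny K(1) by (intro divide_right_mono) auto
        finally have "(norm x - R) / K - 1 \<le> (norm ?y - R) / K" .
        then have "\<epsilon> * ((norm x - R) / K - 1) \<le> \<epsilon> * ((norm ?y - R) / K)"
          using \<epsilon>(1) by (intro mult_left_mono) auto
        then have "b ?y \<le> ?D" by (simp add: b_def right_diff_distrib)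
        then show ?thesis using Suc.IH[OF y True] by linarith
      next
        case False
        \<comment> \<open>Entering the ball in one step means that \<open>x\<close> was within
          \<open>K\<close> of it, so \<open>?D\<close> is at least \<open>M\<close>.\<close>
        then have "(norm x - R) / K \<le> 1" using ny K(1) by (simp add: field_simps)
        then have "\<epsilon> * ((norm x - R) / K) \<le> \<epsilon>" 
          using \<epsilon>(1) by (intro mult_left_le) auto
        then show ?thesis using VtauV[of \<tau> ?y] M[of ?y] False by linarith
      qed
    qed
    then have "Vtau A B U \<sigma> (Suc \<tau>) x \<le> max 0 (\<sigma> x + ?D)"
      by (intro Vtau_Suc_le[OF U, of 0]) auto
    \<comment> \<open>The payment at \<open>x\<close> cancels the extra \<open>\<epsilon>\<close> in
      \<open>?D\<close>.\<close>
    also have "\<dots> \<le> b x" using R[OF Suc.prems] \<epsilon>(1) by (simp add: b_def)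
    finally show ?case .
  qed
  \<comment> \<open>Beyond this radius the unavoidable payments reach \<open>\<bar>M\<bar>\<close>,
    so \<open>b\<close> vanishes.\<close>
  have "norm x \<le> R + K * \<bar>M\<bar> / \<epsilon>" if x: "x \<in> cylinder Q \<beta> e\<^sub>1" "V x \<noteq> 0" for x
  proof (rule ccontr)
    assume "\<not> norm x \<le> R + K * \<bar>M\<bar> / \<epsilon>"
    then have far: "norm x - R > K * \<bar>M\<bar> / \<epsilon>" by simp
    have "K * \<bar>M\<bar> / \<epsilon> \<ge> 0" using K(1) \<epsilon>(1) by simp
    then have "V x \<le> b x" using far x by (intro Vle decay) auto
    moreover have "\<bar>M\<bar> \<le> \<epsilon> * ((norm x - R) / K)"
      using far K(1) \<epsilon>(1) by (simp add: field_simps)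
    then have "b x = 0" by (simp add: b_def)
    ultimately show False using Vnn[of x] x(2) by simp
  qed
  then show ?thesis by (auto simp: bounded_iff)
qed

end
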